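(* Let $\mathcal{C}$ be a binary linear code of length $n$ and dimension $k$, used with BPSK (codeword $\underline c$ mapped to $\underline s$ with $s_t=1-2c_t$) over the AWGN channel $\underline y=\underline s+\underline z$, $\underline z$ with i.i.d. $\mathcal{N}(0,\sigma^2)$ components, $\sigma>0$, and maximum-likelihood decoding. Assume the all-zero codeword $\underline c^{(0)}$ is transmitted and let $E=\bigcup_{\underline s\neq\underline s^{(0)}}\{\underline s^{(0)}\to\underline s\}$. Let $\underline c^{(1)},\underline c^{(2)}$ be fixed codewords with $d_1=W_H(\underline c^{(1)})\ge1$, $d_2=W_H(\underline c^{(2)})\ge1$, $d_{1,2}=W_H(\underline c^{(2)}-\underline c^{(1)})\ge1$, and let $\{C_{i,j,h}\}$ be the tetrahedron spectrum with respect to $\underline c^{(1)},\underline c^{(2)}$. Then $${\rm Pr}\{E\}\le-(2^k-4)\,p_3(d_2,d_{1,2})+\sum_{1\le i,j,h\le n}C_{i,j,h}\,p_4(i,j,h),$$ where the quantities $p_3$ and $p_4$ are as defined in the context.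
   Context: $W_H$ is Hamming weight; $\{\underline s^{(0)}\to\underline s\}=\{\underline y:\|\underline y-\underline s\|\le\|\underline y-\underline s^{(0)}\|\}$; $f(x)=\frac{1}{\sqrt{2\pi}\sigma}e^{-x^2/(2\sigma^2)}$. $C_{i,j,h}$ is the number of codewords $\underline c$ with $W_H(\underline c)=i$, $W_H(\underline c-\underline c^{(1)})=j$, $W_H(\underline c-\underline c^{(2)})=h$ (so the sum over $i,j,h\ge1$ counts codewords other than $\underline c^{(0)},\underline c^{(1)},\underline c^{(2)}$). $p_3(d_2,d_{1,2})=1-\iint_{\Omega_3}f(\xi_1)f(\xi_2)d\xi_1d\xi_2$ with $\Omega_3=\{\xi_1<\sqrt{d_1},\ \xi_1\cos\theta+\xi_2\sin\theta<\sqrt{d_2}\}$, $\cos\theta=(d_1+d_2-d_{1,2})/(2\sqrt{d_1d_2})$, $\theta\in(0,\pi)$; it equals ${\rm Pr}\{(\underline s^{(0)}\to\underline s^{(1)})\cup(\underline s^{(0)}\to\underline s^{(2)})\}$. For a codeword $\underline c$ counted in $C_{i,j,h}$: choose orthonormal coordinates $(\xi_1,\xi_2,\xi_3)$ of a 3-dimensional subspace containing $\underline s^{(1)}-\underline s^{(0)},\underline s^{(2)}-\underline s^{(0)},\underline s-\underline s^{(0)}$ with $\underline s^{(1)}-\underline s^{(0)}$ along the positive $\xi_1$-axis, $\underline s^{(2)}-\underline s^{(0)}$ having unit direction $(\cos\theta,\sin\theta,0)$, and $\underline s-\underline s^{(0)}$ having unit direction $(\sin\phi\cos\alpha,\sin\phi\sin\alpha,\cos\phi)$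 with $\phi\in[0,\pi/2]$ (the angles $\alpha,\phi$ are determined by $d_1,d_2,d_{1,2},i,j,h$). Then $p_4(i,j,h)=1-\iiint_{\Omega}f(\xi_1)f(\xi_2)f(\xi_3)d\xi_1d\xi_2d\xi_3$ with $\Omega=\{\xi_1<\sqrt{d_1},\ \xi_1\cos\theta+\xi_2\sin\theta<\sqrt{d_2},\ \xi_1\sin\phi\cos\alpha+\xi_2\sin\phi\sin\alpha+\xi_3\cos\phi<\sqrt i\}$; it equals ${\rm Pr}\{(\underline s^{(0)}\to\underline s^{(1)})\cup(\underline s^{(0)}\to\underline s^{(2)})\cup(\underline s^{(0)}\to\underline s)\}$. *)

theory Defs
  imports "HOL-Probability.Probability"
begin

text \<open>Binary vectors of length n are functions nat => bool supported in {..<n}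
  (True = 1). Addition/subtraction over GF(2) is pointwise xor.\<close>

definition bvec :: "nat \<Rightarrow> (nat \<Rightarrow> bool) set" where
  "bvec n = {c. \<forall>t. n \<le> t \<longrightarrow> \<not> c t}"

definition bxor :: "(nat \<Rightarrow> bool) \<Rightarrow> (nat \<Rightarrow> bool) \<Rightarrow> (nat \<Rightarrow> bool)" where
  "bxor a b = (\<lambda>t. a t \<noteq> b t)"

definition hamming_weight :: "nat \<Rightarrow> (nat \<Rightarrow> bool) \<Rightarrow> nat" where
  "hamming_weight n c = card {t. t < n \<and> c t}"

text \<open>A binary linear code of length n and dimension k: a subspace of GF(2)^n
  with 2^k elements (over GF(2), a subspace of dimension k has exactly 2^k elements).\<close>
definition binary_linear_code :: "nat \<Rightarrow> nat \<Rightarrow> (nat \<Rightarrow> bool) set \<Rightarrow> bool" where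
  "binary_linear_code n k C \<longleftrightarrow> C \<subseteq> bvec n \<and> (\<lambda>_. False) \<in> C
     \<and> (\<forall>a\<in>C. \<forall>b\<in>C. bxor a b \<in> C) \<and> card C = 2 ^ k"

definition bpsk :: "(nat \<Rightarrow> bool) \<Rightarrow> nat \<Rightarrow> real" where
  "bpsk c t = (if c t then -1 else 1)"

definition gauss :: "real \<Rightarrow> real \<Rightarrow> real" where
  "gauss \<sigma> x = 1 / (sqrt (2 * pi) * \<sigma>) * exp (- (x ^ 2) / (2 * \<sigma> ^ 2))"

definition noise_measure :: "nat \<Rightarrow> real \<Rightarrow> (nat \<Rightarrow> real) measure" where
  "noise_measure n \<sigma> = PiM {..<n} (\<lambda>_. density lborel (gauss \<sigma>))"

definition sqdist_n :: "nat \<Rightarrow> (nat \<Rightarrow> real) \<Rightarrow> (nat \<Rightarrow> real) \<Rightarrow> real" where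
  "sqdist_n n y s = (\<Sum>t<n. (y t - s t)^2)"

definition error_event :: "nat \<Rightarrow> (nat \<Rightarrow> bool) set \<Rightarrow> (nat \<Rightarrow> real) set" where
  "error_event n C = {z \<in> space (PiM {..<n} (\<lambda>_. lborel :: real measure)).
      \<exists>c\<in>C. c \<noteq> (\<lambda>_. False) \<and>
        sqdist_n n (\<lambda>t. bpsk (\<lambda>_. False) t + z t) (bpsk c)
          \<le> sqdist_n n (\<lambda>t. bpsk (\<lambda>_. False) t + z t) (bpsk (\<lambda>_. False))}"

definition tetra_spectrum ::
  "nat \<Rightarrow> (nat \<Rightarrow> bool) set \<Rightarrow> (nat \<Rightarrow> bool) \<Rightarrow> (nat \<Rightarrow> bool) \<Rightarrow> nat \<Rightarrow> nat \<Rightarrow> nat \<Rightarrow> nat" where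
  "tetra_spectrum n C c1 c2 i j h = card {c \<in> C. hamming_weight n c = i
      \<and> hamming_weight n (bxor c c1) = j \<and> hamming_weight n (bxor c c2) = h}"

text \<open>cos theta = (d1 + d2 - d12) / (2 sqrt(d1 d2)), theta in (0,pi), so sin theta >= 0.\<close>
definition cos_theta :: "nat \<Rightarrow> nat \<Rightarrow> nat \<Rightarrow> real" where
  "cos_theta d1 d2 d12 = (real d1 + real d2 - real d12) / (2 * sqrt (real d1 * real d2))"

definition sin_theta :: "nat \<Rightarrow> nat \<Rightarrow> nat \<Rightarrow> real" where
  "sin_theta d1 d2 d12 = sqrt (1 - (cos_theta d1 d2 d12)^2)"

definition p3 :: "real \<Rightarrow> nat \<Rightarrow> nat \<Rightarrow> nat \<Rightarrow> real" where
  "p3 \<sigma> d1 d2 d12 = 1 - (\<integral>x. indicator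
      {(a, b). a < sqrt (real d1) \<and>
               a * cos_theta d1 d2 d12 + b * sin_theta d1 d2 d12 < sqrt (real d2)} x
      * (gauss \<sigma> (fst x) * gauss \<sigma> (snd x)) \<partial>(lborel \<Otimes>\<^sub>M lborel))"

text \<open>Unit direction of s - s0 in the (xi1,xi2,xi3) frame:
  (sin phi cos alpha, sin phi sin alpha, cos phi), determined by the inner products
  <s-s0, s1-s0> = 2(i+d1-j), <s-s0, s2-s0> = 2(i+d2-h), and phi in [0,pi/2].\<close>
definition dir1 :: "nat \<Rightarrow> nat \<Rightarrow> nat \<Rightarrow> nat \<Rightarrow> nat \<Rightarrow> nat \<Rightarrow> real" where
  "dir1 d1 d2 d12 i j h = (real i + real d1 - real j) / (2 * sqrt (real i * real d1))"

definition dir2 :: "nat \<Rightarrow> nat \<Rightarrow> nat \<Rightarrow> nat \<Rightarrow> nat \<Rightarrow> nat \<Rightarrow> real" where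
  "dir2 d1 d2 d12 i j h =
     ((real i + real d2 - real h) / (2 * sqrt (real i * real d2))
       - dir1 d1 d2 d12 i j h * cos_theta d1 d2 d12) / sin_theta d1 d2 d12"

definition dir3 :: "nat \<Rightarrow> nat \<Rightarrow> nat \<Rightarrow> nat \<Rightarrow> nat \<Rightarrow> nat \<Rightarrow> real" where
  "dir3 d1 d2 d12 i j h =
     sqrt (1 - (dir1 d1 d2 d12 i j h)^2 - (dir2 d1 d2 d12 i j h)^2)"

definition p4 :: "real \<Rightarrow> nat \<Rightarrow> nat \<Rightarrow> nat \<Rightarrow> nat \<Rightarrow> nat \<Rightarrow> nat \<Rightarrow> real" where
  "p4 \<sigma> d1 d2 d12 i j h = 1 - (\<integral>x. indicator
      {(a, b, c). a < sqrt (real d1) \<and>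
               a * cos_theta d1 d2 d12 + b * sin_theta d1 d2 d12 < sqrt (real d2) \<and>
               a * dir1 d1 d2 d12 i j h + b * dir2 d1 d2 d12 i j h
                 + c * dir3 d1 d2 d12 i j h < sqrt (real i)} x
      * (gauss \<sigma> (fst x) * gauss \<sigma> (fst (snd x)) * gauss \<sigma> (snd (snd x)))
      \<partial>(lborel \<Otimes>\<^sub>M (lborel \<Otimes>\<^sub>M lborel)))"

end

theory Submission
  imports Defs
begin

text \<open>
  Write \<open>A c\<close> for the pairwise error event of \<open>c\<close> and \<open>B = A c1 \<union> A c2\<close>. The union bound is applied
  only to the parts of the events outside \<open>B\<close>: \<open>P(E) \<le> P(B) + \<Sum>(P(B \<union> A c) - P(B))\<close> over the
  \<open>2^k - 3\<close> remaining nonzero codewords.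

  To identify these probabilities with \<open>p3\<close> and \<open>p4\<close>, note that the events depend on the noise only
  through its projections on three unit vectors. Processing one noise coordinate at a time and using
  rotation invariance of the planar Gaussian, the vector of projections has the law of \<open>L \<xi>\<close> with
  \<open>\<xi>\<close> standard (scaled by \<open>\<sigma>\<close>) in three dimensions and \<open>L\<close> lower triangular with nonnegative
  diagonal. No three-dimensional subspace of the signal space is needed, so \<open>n < 3\<close> and linearly
  dependent directions require no special treatment.
\<close>

section \<open>Rotation invariance of the planar Gaussian\<close>

text \<open>The law of a single noise coordinate, in the form in which it occurs as a factor of
  \<open>noise_measure\<close>.\<close>

abbreviation gauss_measure :: "real \<Rightarrow> real measure" where
  "gauss_measure \<sigma> \<equiv> density lborel (\<lambda>x. ennreal (gauss \<sigma> x))"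

lemma gauss_eq_normal_density: "\<sigma> > 0 \<Longrightarrow> gauss \<sigma> = normal_density 0 \<sigma>"
  by (rule ext) (simp add: gauss_def normal_density_def real_sqrt_mult)

lemma gauss_nonneg [simp]: "\<sigma> > 0 \<Longrightarrow> 0 \<le> gauss \<sigma> x"
  by (simp add: gauss_def)

lemma borel_measurable_gauss [measurable]: "gauss \<sigma> \<in> borel_measurable borel"
  unfolding gauss_def[abs_def] by measurable

lemma prob_space_gauss_measure: "\<sigma> > 0 \<Longrightarrow> prob_space (gauss_measure \<sigma>)"
  by (simp add: gauss_eq_normal_density prob_space_normal_density)

lemma nn_integral_gauss_measure:
  "f \<in> borel_measurable borel \<Longrightarrow>
    (\<integral>\<^sup>+x. f x \<partial>gauss_measure \<sigma>) = (\<integral>\<^sup>+x. ennreal (gauss \<sigma> x) * f x \<partial>lborel)"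
  by (rule nn_integral_density) auto

section \<open>Lebesgue integrals in the plane under translations, shears and rotations\<close>

lemma nn_integral_translate:
  fixes f :: "real \<Rightarrow> ennreal"
  assumes "f \<in> borel_measurable borel"
  shows "(\<integral>\<^sup>+x. f (x + t) \<partial>lborel) = (\<integral>\<^sup>+x. f x \<partial>lborel)"
  using nn_integral_real_affine[OF assms, of 1 t] by (simp add: add.commute)

lemma nn_integral_lborel_swap:
  fixes h :: "real \<Rightarrow> real \<Rightarrow> ennreal"
  assumes "(\<lambda>(x, y). h x y) \<in> borel_measurable (borel \<Otimes>\<^sub>M borel)"
  shows "(\<integral>\<^sup>+x. \<integral>\<^sup>+y. h x y \<partial>lborel \<partial>lborel) = (\<integral>\<^sup>+y. \<integral>\<^sup>+x. h x y \<partial>lborel \<partial>lborel)"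
proof -
  have "case_prod h \<in> borel_measurable (lborel \<Otimes>\<^sub>M lborel)"
    using assms by (simp cong: measurable_cong_sets sets_pair_measure_cong)
  then show ?thesis
    by (rule lborel_pair.Fubini'[symmetric])
qed

text \<open>For fixed \<open>x\<close> the shear is a translation of the inner variable by
  \<open>p * x\<close>.\<close>

lemma nn_integral_shear_snd:
  fixes h :: "real \<Rightarrow> real \<Rightarrow> ennreal"
  assumes [measurable]: "(\<lambda>(x, y). h x y) \<in> borel_measurable (borel \<Otimes>\<^sub>M borel)"
  shows "(\<integral>\<^sup>+x. \<integral>\<^sup>+y. h x (y + p * x) \<partial>lborel \<partial>lborel) = (\<integral>\<^sup>+x. \<integral>\<^sup>+y. h x y \<partial>lborel \<partial>lborel)"
  by (rule nn_integral_cong, rule nn_integral_translate) measurable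

text \<open>Here the shear moves the outer variable, so Tonelli first brings that variable inside,
  where the shear is again a translation.\<close>

lemma nn_integral_shear_fst:
  fixes h :: "real \<Rightarrow> real \<Rightarrow> ennreal"
  assumes [measurable]: "(\<lambda>(x, y). h x y) \<in> borel_measurable (borel \<Otimes>\<^sub>M borel)"
  shows "(\<integral>\<^sup>+x. \<integral>\<^sup>+y. h (x + p * y) y \<partial>lborel \<partial>lborel) = (\<integral>\<^sup>+x. \<integral>\<^sup>+y. h x y \<partial>lborel \<partial>lborel)"
proof -
  have "(\<integral>\<^sup>+x. \<integral>\<^sup>+y. h (x + p * y) y \<partial>lborel \<partial>lborel) = (\<integral>\<^sup>+y. \<integral>\<^sup>+x. h (x + p * y) y \<partial>lborel \<partial>lborel)"
    by (rule nn_integral_lborel_swap) measurable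
  also have "\<dots> = (\<integral>\<^sup>+y. \<integral>\<^sup>+x. h x y \<partial>lborel \<partial>lborel)"
    by (rule nn_integral_cong, rule nn_integral_translate) measurable
  also have "\<dots> = (\<integral>\<^sup>+x. \<integral>\<^sup>+y. h x y \<partial>lborel \<partial>lborel)"
    by (rule nn_integral_lborel_swap[symmetric]) measurable
  finally show ?thesis .
qed

text \<open>A rotation by an angle other than \<open>\<pi>\<close> is a product of three shears, and each shear
  preserves Lebesgue measure by Fubini and translation invariance.\<close>

lemma nn_integral_rotate:
  fixes h :: "real \<Rightarrow> real \<Rightarrow> ennreal"
  assumes [measurable]: "(\<lambda>(x, y). h x y) \<in> borel_measurable (borel \<Otimes>\<^sub>M borel)"
    and cs: "c\<^sup>2 + s\<^sup>2 = 1" and c: "c \<ge> 0"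
  shows "(\<integral>\<^sup>+x. \<integral>\<^sup>+y. h (c * x + s * y) (c * y - s * x) \<partial>lborel \<partial>lborel)
    = (\<integral>\<^sup>+x. \<integral>\<^sup>+y. h x y \<partial>lborel \<partial>lborel)"
proof -
  \<comment> \<open>With \<open>c\<close> and \<open>s\<close> the cosine and sine of the rotation
    angle, \<open>p\<close> is the tangent of half that angle. The assumption
    \<open>c \<ge> 0\<close> keeps the denominator positive.\<close>
  define p where "p = s / (1 + c)"
  have p1: "p * (1 + c) = s"
    using c by (simp add: p_def)
  have "p * s * (1 + c) = s * (p * (1 + c))"
    by (simp add: ac_simps)
  also have "\<dots> = (1 - c) * (1 + c)"
    unfolding p1 using cs by (simp add: power2_eq_square algebra_simps)
  finally have "p * s * (1 + c) = (1 - c) * (1 + c)" .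
  then have ps: "p * s = 1 - c"
    using c by simp
  \<comment> \<open>The rotation factors as a shear of \<open>x\<close> by \<open>p\<close>, then of
    \<open>y\<close> by \<open>- s\<close>, then of \<open>x\<close> by \<open>p\<close> once more.
    \<open>h1\<close> absorbs the last of these and \<open>h2\<close> the last two;
    \<open>h3\<close> below checks the factorization by means of
    \<open>p * s = 1 - c\<close>.\<close>
  define h1 where "h1 = (\<lambda>x y. h (x + p * y) y)"
  define h2 where "h2 = (\<lambda>x y. h1 x (y + (- s) * x))"
  have [measurable]: "(\<lambda>(x, y). h1 x y) \<in> borel_measurable (borel \<Otimes>\<^sub>M borel)"
    unfolding h1_def by measurable
  have [measurable]: "(\<lambda>(x, y). h2 x y) \<in> borel_measurable (borel \<Otimes>\<^sub>M borel)"
    unfolding h2_def by measurable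
  have h3: "h (c * x + s * y) (c * y - s * x) = h2 (x + p * y) y" for x y
  proof -
    have "x + p * y + p * (y + (- s) * (x + p * y)) = (1 - p * s) * x + p * (1 + (1 - p * s)) * y"
      by (simp add: algebra_simps)
    then have "c * x + s * y = x + p * y + p * (y + (- s) * (x + p * y))"
      by (simp add: ps p1)
    moreover have "y + (- s) * (x + p * y) = (1 - p * s) * y - s * x"
      by (simp add: algebra_simps)
    then have "c * y - s * x = y + (- s) * (x + p * y)"
      by (simp add: ps)
    ultimately show ?thesis
      unfolding h2_def h1_def by simp
  qed
  show ?thesis
    unfolding h3
    by (subst nn_integral_shear_fst, measurable)
       (unfold h2_def, subst nn_integral_shear_snd, measurable, unfold h1_def,
        subst nn_integral_shear_fst, measurable)
qed

lemma nn_integral_gauss_pair: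
  fixes h :: "real \<Rightarrow> real \<Rightarrow> ennreal"
  assumes [measurable]: "(\<lambda>(x, y). h x y) \<in> borel_measurable (borel \<Otimes>\<^sub>M borel)"
  shows "(\<integral>\<^sup>+x. \<integral>\<^sup>+y. h x y \<partial>gauss_measure \<sigma> \<partial>gauss_measure \<sigma>)
    = (\<integral>\<^sup>+x. \<integral>\<^sup>+y. ennreal (gauss \<sigma> x) * (ennreal (gauss \<sigma> y) * h x y) \<partial>lborel \<partial>lborel)"
proof -
  have "(\<integral>\<^sup>+y. h x y \<partial>gauss_measure \<sigma>) = (\<integral>\<^sup>+y. ennreal (gauss \<sigma> y) * h x y \<partial>lborel)" for x
    by (rule nn_integral_gauss_measure) measurable
  then show ?thesis
    by (simp add: nn_integral_gauss_measure nn_integral_cmult)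
qed

text \<open>The product density depends on the point only through
  \<open>x\<^sup>2 + y\<^sup>2\<close>, which a rotation preserves. Moved into the integrand, it
  turns the claim into the one for Lebesgue measure.\<close>

lemma nn_integral_gauss_rotate:
  fixes h :: "real \<Rightarrow> real \<Rightarrow> ennreal"
  assumes [measurable]: "(\<lambda>(x, y). h x y) \<in> borel_measurable (borel \<Otimes>\<^sub>M borel)"
    and \<sigma>: "\<sigma> > 0" and cs: "c\<^sup>2 + s\<^sup>2 = 1" and c: "c \<ge> 0"
  shows "(\<integral>\<^sup>+x. \<integral>\<^sup>+y. h (c * x + s * y) (c * y - s * x) \<partial>gauss_measure \<sigma> \<partial>gauss_measure \<sigma>)
    = (\<integral>\<^sup>+x. \<integral>\<^sup>+y. h x y \<partial>gauss_measure \<sigma> \<partial>gauss_measure \<sigma>)"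
proof -
  have g: "gauss \<sigma> x * gauss \<sigma> y
      = (1 / (sqrt (2 * pi) * \<sigma>))\<^sup>2 * exp (- (x\<^sup>2 + y\<^sup>2) / (2 * \<sigma>\<^sup>2))" for x y
    by (simp add: gauss_def power2_eq_square exp_add[symmetric] add_divide_distrib diff_divide_distrib)
  have rot: "gauss \<sigma> (c * x + s * y) * gauss \<sigma> (c * y - s * x) = gauss \<sigma> x * gauss \<sigma> y" for x y
  proof -
    have "(c * x + s * y)\<^sup>2 + (c * y - s * x)\<^sup>2 = (c\<^sup>2 + s\<^sup>2) * (x\<^sup>2 + y\<^sup>2)"
      by (simp add: power2_eq_square algebra_simps)
    then show ?thesis
      unfolding g cs by simp
  qed
  define H where "H = (\<lambda>x y. ennreal (gauss \<sigma> x * gauss \<sigma> y) * h x y)"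
  have [measurable]: "(\<lambda>(x, y). H x y) \<in> borel_measurable (borel \<Otimes>\<^sub>M borel)"
    unfolding H_def by measurable
  have "(\<integral>\<^sup>+x. \<integral>\<^sup>+y. h (c * x + s * y) (c * y - s * x) \<partial>gauss_measure \<sigma> \<partial>gauss_measure \<sigma>)
      = (\<integral>\<^sup>+x. \<integral>\<^sup>+y. H (c * x + s * y) (c * y - s * x) \<partial>lborel \<partial>lborel)"
    by (subst nn_integral_gauss_pair, measurable)
       (simp only: H_def rot, simp add: ennreal_mult \<sigma> mult.assoc)
  also have "\<dots> = (\<integral>\<^sup>+x. \<integral>\<^sup>+y. H x y \<partial>lborel \<partial>lborel)"
    by (rule nn_integral_rotate[OF _ cs c]) measurable
  also have "\<dots> = (\<integral>\<^sup>+x. \<integral>\<^sup>+y. h x y \<partial>gauss_measure \<sigma> \<partial>gauss_measure \<sigma>)"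
    by (subst nn_integral_gauss_pair, measurable)
       (simp add: H_def ennreal_mult \<sigma> mult.assoc)
  finally show ?thesis .
qed

section \<open>Rotations in one coordinate plane of a longer iterated Gaussian integral\<close>

lemma nn_integral_gauss_swap:
  fixes h :: "real \<Rightarrow> real \<Rightarrow> ennreal"
  assumes "\<sigma> > 0" and "(\<lambda>(x, y). h x y) \<in> borel_measurable (borel \<Otimes>\<^sub>M borel)"
  shows "(\<integral>\<^sup>+x. \<integral>\<^sup>+y. h x y \<partial>gauss_measure \<sigma> \<partial>gauss_measure \<sigma>)
    = (\<integral>\<^sup>+y. \<integral>\<^sup>+x. h x y \<partial>gauss_measure \<sigma> \<partial>gauss_measure \<sigma>)"
proof -
  interpret G: prob_space "gauss_measure \<sigma>"
    using assms(1) by (rule prob_space_gauss_measure)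
  interpret pair_sigma_finite "gauss_measure \<sigma>" "gauss_measure \<sigma>" ..
  have "case_prod h \<in> borel_measurable (gauss_measure \<sigma> \<Otimes>\<^sub>M gauss_measure \<sigma>)"
    using assms(2) by (simp cong: measurable_cong_sets sets_pair_measure_cong)
  then show ?thesis
    by (rule Fubini'[symmetric])
qed

text \<open>Lets the measurability prover pass through Gaussian integrals. Its side condition
  \<open>\<sigma> > 0\<close>, which gives a probability measure, is the reason why later lemmas
  declare that assumption \<open>[measurable]\<close>.\<close>

lemma borel_measurable_nn_integral_gauss [measurable (raw)]:
  assumes "\<sigma> > 0" and "(\<lambda>(x, y). h x y) \<in> borel_measurable (M \<Otimes>\<^sub>M borel)"
  shows "(\<lambda>x. \<integral>\<^sup>+y. h x y \<partial>gauss_measure \<sigma>) \<in> borel_measurable M"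
proof -
  interpret G: prob_space "gauss_measure \<sigma>"
    using assms(1) by (rule prob_space_gauss_measure)
  have "(\<lambda>(x, y). h x y) \<in> borel_measurable (M \<Otimes>\<^sub>M gauss_measure \<sigma>)"
    using assms(2) by (simp cong: measurable_cong_sets sets_pair_measure_cong)
  then show ?thesis
    by (rule G.borel_measurable_nn_integral)
qed

text \<open>The rotation mixes the outermost and the innermost variable. Moving the passive variable
  \<open>t\<close> to the outside makes the other two adjacent, and the planar case applies for each
  \<open>t\<close>.\<close>

lemma nn_integral_gauss_rotate3:
  fixes h :: "real \<times> real \<times> real \<Rightarrow> ennreal"
  assumes [measurable]: "h \<in> borel_measurable (borel \<Otimes>\<^sub>M borel \<Otimes>\<^sub>M borel)"
    and \<sigma>[measurable]: "\<sigma> > 0" and cs: "c\<^sup>2 + s\<^sup>2 = 1" and c: "c \<ge> 0"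
  shows "(\<integral>\<^sup>+y. \<integral>\<^sup>+t. \<integral>\<^sup>+r. h (c * y + s * r, t, c * r - s * y)
        \<partial>gauss_measure \<sigma> \<partial>gauss_measure \<sigma> \<partial>gauss_measure \<sigma>)
    = (\<integral>\<^sup>+y. \<integral>\<^sup>+t. \<integral>\<^sup>+r. h (y, t, r) \<partial>gauss_measure \<sigma> \<partial>gauss_measure \<sigma> \<partial>gauss_measure \<sigma>)"
    (is "?l = ?r")
proof -
  have "?l = (\<integral>\<^sup>+t. \<integral>\<^sup>+y. \<integral>\<^sup>+r. h (c * y + s * r, t, c * r - s * y)
        \<partial>gauss_measure \<sigma> \<partial>gauss_measure \<sigma> \<partial>gauss_measure \<sigma>)"
    by (rule nn_integral_gauss_swap[OF \<sigma>]) measurable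
  also have "\<dots> = (\<integral>\<^sup>+t. \<integral>\<^sup>+y. \<integral>\<^sup>+r. h (y, t, r)
        \<partial>gauss_measure \<sigma> \<partial>gauss_measure \<sigma> \<partial>gauss_measure \<sigma>)"
    by (rule nn_integral_cong, rule nn_integral_gauss_rotate[OF _ \<sigma> cs c]) measurable
  also have "\<dots> = ?r"
    by (rule nn_integral_gauss_swap[OF \<sigma>]) measurable
  finally show ?thesis .
qed

text \<open>The same exchange with \<open>y\<close> reduces the claim, for each fixed
  \<open>y\<close>, to three variables.\<close>

lemma nn_integral_gauss_rotate4:
  fixes h :: "real \<times> real \<times> real \<times> real \<Rightarrow> ennreal"
  assumes [measurable]:
      "h \<in> borel_measurable (borel \<Otimes>\<^sub>M borel \<Otimes>\<^sub>M borel \<Otimes>\<^sub>M borel)"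
    and \<sigma>[measurable]: "\<sigma> > 0" and cs: "c\<^sup>2 + s\<^sup>2 = 1" and c: "c \<ge> 0"
  shows "(\<integral>\<^sup>+x. \<integral>\<^sup>+y. \<integral>\<^sup>+t. \<integral>\<^sup>+r. h (c * x + s * r, y, t, c * r - s * x)
        \<partial>gauss_measure \<sigma> \<partial>gauss_measure \<sigma> \<partial>gauss_measure \<sigma> \<partial>gauss_measure \<sigma>)
    = (\<integral>\<^sup>+x. \<integral>\<^sup>+y. \<integral>\<^sup>+t. \<integral>\<^sup>+r. h (x, y, t, r)
        \<partial>gauss_measure \<sigma> \<partial>gauss_measure \<sigma> \<partial>gauss_measure \<sigma> \<partial>gauss_measure \<sigma>)"
    (is "?l = ?r")
proof -
  have "?l = (\<integral>\<^sup>+y. \<integral>\<^sup>+x. \<integral>\<^sup>+t. \<integral>\<^sup>+r. h (c * x + s * r, y, t, c * r - s * x)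
        \<partial>gauss_measure \<sigma> \<partial>gauss_measure \<sigma> \<partial>gauss_measure \<sigma> \<partial>gauss_measure \<sigma>)"
    by (rule nn_integral_gauss_swap[OF \<sigma>]) measurable
  also have "\<dots> = (\<integral>\<^sup>+y. \<integral>\<^sup>+x. \<integral>\<^sup>+t. \<integral>\<^sup>+r. h (x, y, t, r)
        \<partial>gauss_measure \<sigma> \<partial>gauss_measure \<sigma> \<partial>gauss_measure \<sigma> \<partial>gauss_measure \<sigma>)"
  proof (rule nn_integral_cong)
    fix y
    have "(\<lambda>(x, t, r). h (x, y, t, r)) \<in> borel_measurable (borel \<Otimes>\<^sub>M borel \<Otimes>\<^sub>M borel)"
      by measurable
    from nn_integral_gauss_rotate3[OF this \<sigma> cs c]
    show "(\<integral>\<^sup>+x. \<integral>\<^sup>+t. \<integral>\<^sup>+r. h (c * x + s * r, y, t, c * r - s * x)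
        \<partial>gauss_measure \<sigma> \<partial>gauss_measure \<sigma> \<partial>gauss_measure \<sigma>)
      = (\<integral>\<^sup>+x. \<integral>\<^sup>+t. \<integral>\<^sup>+r. h (x, y, t, r)
        \<partial>gauss_measure \<sigma> \<partial>gauss_measure \<sigma> \<partial>gauss_measure \<sigma>)"
      by simp
  qed
  also have "\<dots> = ?r"
    by (rule nn_integral_gauss_swap[OF \<sigma>]) measurable
  finally show ?thesis .
qed

section \<open>Triangular form of a Gaussian vector\<close>

text \<open>Rotates the pair \<open>(l, u)\<close> onto the nonnegative first axis by taking
  \<open>c\<close> and \<open>s\<close> to be \<open>l\<close> and \<open>- u\<close> divided by the
  length of the pair; the new first entry is that length. From \<open>l \<ge> 0\<close> follows
  \<open>c \<ge> 0\<close>, as the rotation lemmas for integrals require. For the zero pair the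
  identity serves.\<close>

lemma givens_rotation_exists:
  fixes l u :: real
  assumes "l \<ge> 0"
  obtains c s where "c\<^sup>2 + s\<^sup>2 = 1" "c \<ge> 0" "s * l + c * u = 0" "c * l - s * u \<ge> 0"
proof (cases "l\<^sup>2 + u\<^sup>2 = 0")
  case True
  then show ?thesis
    using that[of 1 0] by simp
next
  case False
  define \<rho> where "\<rho> = sqrt (l\<^sup>2 + u\<^sup>2)"
  have \<rho>: "\<rho> > 0" "\<rho>\<^sup>2 = l\<^sup>2 + u\<^sup>2"
    using False by (auto simp: \<rho>_def sum_power2_gt_zero_iff less_le)
  have sq: "(l / \<rho>)\<^sup>2 + (- u / \<rho>)\<^sup>2 = 1"
    using \<rho> False by (simp add: power_divide flip: add_divide_distrib)
  have nonneg: "l / \<rho> * l - - u / \<rho> * u \<ge> 0"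
    using \<rho>(1) by (simp add: divide_simps)
  show ?thesis
    by (rule that[OF sq _ _ nonneg]) (use \<rho> assms in \<open>auto simp: field_simps\<close>)
qed

text \<open>Multiplying a matrix on the right by a rotation of two columns preserves the inner
  products of its rows; this tracks the Gram matrix through each rotation.\<close>

lemma rotation_inner:
  fixes c s :: real
  assumes "c\<^sup>2 + s\<^sup>2 = 1"
  shows "(c * a - s * b) * (c * a' - s * b') + (s * a + c * b) * (s * a' + c * b') = a * a' + b * b'"
proof -
  have "(c * a - s * b) * (c * a' - s * b') + (s * a + c * b) * (s * a' + c * b')
      = (c\<^sup>2 + s\<^sup>2) * (a * a' + b * b')"
    by (simp add: power2_eq_square algebra_simps)
  then show ?thesis
    by (simp add: assms)
qed

text \<open>Appending the column \<open>(u, v, w)\<close> to a lower triangular matrix and clearing it by three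
  Givens rotations.\<close>

lemma gauss_triangular_step:
  fixes l11 l21 l31 l22 l32 l33 u v w \<sigma> :: real
  assumes \<sigma>[measurable]: "\<sigma> > 0" and nonneg: "l11 \<ge> 0" "l22 \<ge> 0" "l33 \<ge> 0"
  shows "\<exists>m11 m21 m31 m22 m32 m33. m11 \<ge> 0 \<and> m22 \<ge> 0 \<and> m33 \<ge> 0
    \<and> m11 * m11 = l11 * l11 + u * u
    \<and> m11 * m21 = l11 * l21 + u * v
    \<and> m11 * m31 = l11 * l31 + u * w
    \<and> m21 * m21 + m22 * m22 = l21 * l21 + l22 * l22 + v * v
    \<and> m21 * m31 + m22 * m32 = l21 * l31 + l22 * l32 + v * w
    \<and> m31 * m31 + m32 * m32 + m33 * m33 = l31 * l31 + l32 * l32 + l33 * l33 + w * w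
    \<and> (\<forall>F :: real \<times> real \<times> real \<Rightarrow> ennreal.
      F \<in> borel_measurable (borel \<Otimes>\<^sub>M borel \<Otimes>\<^sub>M borel) \<longrightarrow>
      (\<integral>\<^sup>+x. \<integral>\<^sup>+y. \<integral>\<^sup>+t. \<integral>\<^sup>+r.
          F (l11 * x + r * u, l21 * x + l22 * y + r * v, l31 * x + l32 * y + l33 * t + r * w)
        \<partial>gauss_measure \<sigma> \<partial>gauss_measure \<sigma> \<partial>gauss_measure \<sigma> \<partial>gauss_measure \<sigma>)
      = (\<integral>\<^sup>+x. \<integral>\<^sup>+y. \<integral>\<^sup>+t. F (m11 * x, m21 * x + m22 * y, m31 * x + m32 * y + m33 * t)
        \<partial>gauss_measure \<sigma> \<partial>gauss_measure \<sigma> \<partial>gauss_measure \<sigma>))"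
proof -
  \<comment> \<open>The first rotation takes the entries \<open>(l11, u)\<close> of the first row to
    \<open>(m11, 0)\<close> and leaves \<open>v'\<close>, \<open>w'\<close> in the last column. The
    second takes \<open>(l22, v')\<close> to \<open>(m22, 0)\<close> and leaves \<open>w''\<close>;
    the third takes \<open>(l33, w'')\<close> to \<open>(m33, 0)\<close>.\<close>
  obtain c s where cs: "c\<^sup>2 + s\<^sup>2 = 1" "c \<ge> 0" "s * l11 + c * u = 0" "c * l11 - s * u \<ge> 0"
    using givens_rotation_exists[OF nonneg(1)] .
  define m11 m21 m31 where "m11 = c * l11 - s * u" and "m21 = c * l21 - s * v"
    and "m31 = c * l31 - s * w"
  define v' w' where "v' = s * l21 + c * v" and "w' = s * l31 + c * w"
  obtain d e where de: "d\<^sup>2 + e\<^sup>2 = 1" "d \<ge> 0" "e * l22 + d * v' = 0" "d * l22 - e * v' \<ge> 0"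
    using givens_rotation_exists[OF nonneg(2)] .
  define m22 m32 where "m22 = d * l22 - e * v'" and "m32 = d * l32 - e * w'"
  define w'' where "w'' = e * l32 + d * w'"
  obtain f g where fg: "f\<^sup>2 + g\<^sup>2 = 1" "f \<ge> 0" "g * l33 + f * w'' = 0" "f * l33 - g * w'' \<ge> 0"
    using givens_rotation_exists[OF nonneg(3)] .
  define m33 where "m33 = f * l33 - g * w''"
  note I1 = rotation_inner[OF cs(1)] and I2 = rotation_inner[OF de(1)]
    and I3 = rotation_inner[OF fg(1)]
  \<comment> \<open>The cleared entries drop out of these inner products. The auxiliary terms in
    \<open>v'\<close>, \<open>w'\<close> and \<open>w''\<close> cancel when the \<open>H\<close>,
    \<open>K\<close> and \<open>L\<close> identities are added, which yields the Gram equations of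
    the statement.\<close>
  have G11: "m11 * m11 = l11 * l11 + u * u" and G12: "m11 * m21 = l11 * l21 + u * v"
    and G13: "m11 * m31 = l11 * l31 + u * w"
    using I1[of l11 u l11 u] I1[of l11 u l21 v] I1[of l11 u l31 w]
    unfolding cs(3) m11_def m21_def m31_def by simp_all
  have H22: "m21 * m21 + v' * v' = l21 * l21 + v * v"
    and H23: "m21 * m31 + v' * w' = l21 * l31 + v * w"
    and H33: "m31 * m31 + w' * w' = l31 * l31 + w * w"
    using I1[of l21 v l21 v] I1[of l21 v l31 w] I1[of l31 w l31 w]
    unfolding m21_def m31_def v'_def w'_def by simp_all
  have K22: "m22 * m22 = l22 * l22 + v' * v'" and K23: "m22 * m32 = l22 * l32 + v' * w'"
    and K33: "m32 * m32 + w'' * w'' = l32 * l32 + w' * w'"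
    using I2[of l22 v' l22 v'] I2[of l22 v' l32 w'] I2[of l32 w' l32 w']
    unfolding de(3) m22_def m32_def w''_def by simp_all
  have L33: "m33 * m33 = l33 * l33 + w'' * w''"
    using I3[of l33 w'' l33 w''] unfolding fg(3) m33_def by simp
  interpret G: prob_space "gauss_measure \<sigma>"
    using \<sigma> by (rule prob_space_gauss_measure)
  have one: "emeasure (gauss_measure \<sigma>) UNIV = 1"
    using G.emeasure_space_1 by simp
  have E: "(\<integral>\<^sup>+x. \<integral>\<^sup>+y. \<integral>\<^sup>+t. \<integral>\<^sup>+r.
          F (l11 * x + r * u, l21 * x + l22 * y + r * v, l31 * x + l32 * y + l33 * t + r * w)
        \<partial>gauss_measure \<sigma> \<partial>gauss_measure \<sigma> \<partial>gauss_measure \<sigma> \<partial>gauss_measure \<sigma>)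
      = (\<integral>\<^sup>+x. \<integral>\<^sup>+y. \<integral>\<^sup>+t. F (m11 * x, m21 * x + m22 * y, m31 * x + m32 * y + m33 * t)
        \<partial>gauss_measure \<sigma> \<partial>gauss_measure \<sigma> \<partial>gauss_measure \<sigma>)"
    if F[measurable]: "F \<in> borel_measurable (borel \<Otimes>\<^sub>M borel \<Otimes>\<^sub>M borel)"
    for F :: "real \<times> real \<times> real \<Rightarrow> ennreal"
  proof -
    define h1 where "h1 = (\<lambda>(x, y, t, r). F (l11 * x + r * u, l21 * x + l22 * y + r * v,
        l31 * x + l32 * y + l33 * t + r * w))"
    have [measurable]: "h1 \<in> borel_measurable (borel \<Otimes>\<^sub>M borel \<Otimes>\<^sub>M borel \<Otimes>\<^sub>M borel)"
      unfolding h1_def by measurable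
    \<comment> \<open>The integrand after the first rotation: its first component no longer contains
      \<open>r\<close>. The variable \<open>x\<close> is passive from here on and becomes a
      parameter.\<close>
    define h2 where "h2 x = (\<lambda>(y, t, r). F (m11 * x, m21 * x + l22 * y + r * v',
        m31 * x + l32 * y + l33 * t + r * w'))" for x
    have [measurable]: "h2 x \<in> borel_measurable (borel \<Otimes>\<^sub>M borel \<Otimes>\<^sub>M borel)" for x
      unfolding h2_def by measurable
    define h3 where "h3 x y t r = F (m11 * x, m21 * x + m22 * y,
        m31 * x + m32 * y + l33 * t + r * w'')" for x y t r
    have [measurable]: "(\<lambda>(t, r). h3 x y t r) \<in> borel_measurable (borel \<Otimes>\<^sub>M borel)" for x y
      unfolding h3_def by measurable
    have r1: "h1 (c * x + s * r, y, t, c * r - s * x) = h2 x (y, t, r)" for x y t r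
    proof -
      have "l11 * (c * x + s * r) + (c * r - s * x) * u = m11 * x + r * (s * l11 + c * u)"
        by (simp add: m11_def algebra_simps)
      then show ?thesis
        unfolding h1_def h2_def cs(3)
        by (simp add: m21_def m31_def v'_def w'_def algebra_simps)
    qed
    have r2: "h2 x (d * y + e * r, t, d * r - e * y) = h3 x y t r" for x y t r
    proof -
      have "l22 * (d * y + e * r) + (d * r - e * y) * v' = m22 * y + r * (e * l22 + d * v')"
        by (simp add: m22_def algebra_simps)
      then have "m21 * x + l22 * (d * y + e * r) + (d * r - e * y) * v' = m21 * x + m22 * y"
        unfolding de(3) by simp
      then show ?thesis
        unfolding h2_def h3_def by (simp add: m32_def w''_def algebra_simps)
    qed
    have r3: "h3 x y (f * t + g * r) (f * r - g * t)
        = F (m11 * x, m21 * x + m22 * y, m31 * x + m32 * y + m33 * t)" for x y t r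
    proof -
      have "l33 * (f * t + g * r) + (f * r - g * t) * w'' = m33 * t + r * (g * l33 + f * w'')"
        by (simp add: m33_def algebra_simps)
      then have "m31 * x + m32 * y + l33 * (f * t + g * r) + (f * r - g * t) * w''
          = m31 * x + m32 * y + m33 * t"
        unfolding fg(3) by simp
      then show ?thesis
        unfolding h3_def by (simp only:)
    qed
    have "(\<integral>\<^sup>+x. \<integral>\<^sup>+y. \<integral>\<^sup>+t. \<integral>\<^sup>+r. h1 (x, y, t, r)
          \<partial>gauss_measure \<sigma> \<partial>gauss_measure \<sigma> \<partial>gauss_measure \<sigma> \<partial>gauss_measure \<sigma>)
        = (\<integral>\<^sup>+x. \<integral>\<^sup>+y. \<integral>\<^sup>+t. \<integral>\<^sup>+r. h2 x (y, t, r)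
          \<partial>gauss_measure \<sigma> \<partial>gauss_measure \<sigma> \<partial>gauss_measure \<sigma> \<partial>gauss_measure \<sigma>)"
      unfolding r1[symmetric] by (rule nn_integral_gauss_rotate4[OF _ \<sigma> cs(1,2), symmetric]) measurable
    also have "\<dots> = (\<integral>\<^sup>+x. \<integral>\<^sup>+y. \<integral>\<^sup>+t. \<integral>\<^sup>+r. h3 x y t r
          \<partial>gauss_measure \<sigma> \<partial>gauss_measure \<sigma> \<partial>gauss_measure \<sigma> \<partial>gauss_measure \<sigma>)"
      unfolding r2[symmetric]
      by (rule nn_integral_cong, rule nn_integral_gauss_rotate3[OF _ \<sigma> de(1,2), symmetric]) measurable
    also have "\<dots> = (\<integral>\<^sup>+x. \<integral>\<^sup>+y. \<integral>\<^sup>+t. \<integral>\<^sup>+r. h3 x y (f * t + g * r) (f * r - g * t)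
          \<partial>gauss_measure \<sigma> \<partial>gauss_measure \<sigma> \<partial>gauss_measure \<sigma> \<partial>gauss_measure \<sigma>)"
      by (rule nn_integral_cong, rule nn_integral_cong,
          rule nn_integral_gauss_rotate[OF _ \<sigma> fg(1,2), symmetric]) measurable
    \<comment> \<open>After the third rotation the integrand is free of \<open>r\<close>, so the
      innermost integral only contributes the total mass 1.\<close>
    finally show ?thesis
      unfolding r3 by (simp add: h1_def one)
  qed
  show ?thesis
  proof (rule exI[of _ m11], rule exI[of _ m21], rule exI[of _ m31],
      rule exI[of _ m22], rule exI[of _ m32], rule exI[of _ m33], intro conjI allI impI)
    show "m21 * m21 + m22 * m22 = l21 * l21 + l22 * l22 + v * v"
      using H22 K22 by linarith
    show "m21 * m31 + m22 * m32 = l21 * l31 + l22 * l32 + v * w"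
      using H23 K23 by linarith
    show "m31 * m31 + m32 * m32 + m33 * m33 = l31 * l31 + l32 * l32 + l33 * l33 + w * w"
      using H33 K33 L33 by linarith
  qed (use cs de fg G11 G12 G13 E in \<open>simp_all add: m11_def m22_def m33_def\<close>)
qed

text \<open>Induction on \<open>n\<close>: a further noise coordinate appends the column
  \<open>(u n, v n, w n)\<close> to the triangular matrix, and the preceding lemma absorbs it. The
  entries are recorded only through the Gram equations, which suffice to identify them
  later.\<close>

lemma gauss_vector_triangular:
  fixes u v w :: "nat \<Rightarrow> real"
  assumes \<sigma>[measurable]: "\<sigma> > 0"
  shows "\<exists>l11 l21 l31 l22 l32 l33. l11 \<ge> 0 \<and> l22 \<ge> 0 \<and> l33 \<ge> 0
    \<and> l11 * l11 = (\<Sum>t<n. u t * u t)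
    \<and> l11 * l21 = (\<Sum>t<n. u t * v t)
    \<and> l11 * l31 = (\<Sum>t<n. u t * w t)
    \<and> l21 * l21 + l22 * l22 = (\<Sum>t<n. v t * v t)
    \<and> l21 * l31 + l22 * l32 = (\<Sum>t<n. v t * w t)
    \<and> l31 * l31 + l32 * l32 + l33 * l33 = (\<Sum>t<n. w t * w t)
    \<and> (\<forall>F :: real \<times> real \<times> real \<Rightarrow> ennreal.
        F \<in> borel_measurable (borel \<Otimes>\<^sub>M borel \<Otimes>\<^sub>M borel) \<longrightarrow>
        (\<integral>\<^sup>+z. F (\<Sum>t<n. z t * u t, \<Sum>t<n. z t * v t, \<Sum>t<n. z t * w t) \<partial>noise_measure n \<sigma>)
        = (\<integral>\<^sup>+x. \<integral>\<^sup>+y. \<integral>\<^sup>+t. F (l11 * x, l21 * x + l22 * y, l31 * x + l32 * y + l33 * t)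
          \<partial>gauss_measure \<sigma> \<partial>gauss_measure \<sigma> \<partial>gauss_measure \<sigma>))"
proof (induction n)
  case 0
  interpret G: prob_space "gauss_measure \<sigma>"
    using \<sigma> by (rule prob_space_gauss_measure)
  have one: "emeasure (gauss_measure \<sigma>) UNIV = 1"
    using G.emeasure_space_1 by simp
  show ?case
    \<comment> \<open>With no coordinates all sums are empty, so the zero matrix works.\<close>
    by (rule exI[of _ 0])+ (simp add: noise_measure_def PiM_empty nn_integral_count_space_finite one)
next
  case (Suc n)
  obtain l11 l21 l31 l22 l32 l33 where nonneg: "l11 \<ge> 0" "l22 \<ge> 0" "l33 \<ge> 0"
    and gram: "l11 * l11 = (\<Sum>t<n. u t * u t)" "l11 * l21 = (\<Sum>t<n. u t * v t)"
      "l11 * l31 = (\<Sum>t<n. u t * w t)" "l21 * l21 + l22 * l22 = (\<Sum>t<n. v t * v t)"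
      "l21 * l31 + l22 * l32 = (\<Sum>t<n. v t * w t)"
      "l31 * l31 + l32 * l32 + l33 * l33 = (\<Sum>t<n. w t * w t)"
    and IH: "\<And>F :: real \<times> real \<times> real \<Rightarrow> ennreal.
        F \<in> borel_measurable (borel \<Otimes>\<^sub>M borel \<Otimes>\<^sub>M borel) \<Longrightarrow>
        (\<integral>\<^sup>+z. F (\<Sum>t<n. z t * u t, \<Sum>t<n. z t * v t, \<Sum>t<n. z t * w t) \<partial>noise_measure n \<sigma>)
        = (\<integral>\<^sup>+x. \<integral>\<^sup>+y. \<integral>\<^sup>+t. F (l11 * x, l21 * x + l22 * y, l31 * x + l32 * y + l33 * t)
          \<partial>gauss_measure \<sigma> \<partial>gauss_measure \<sigma> \<partial>gauss_measure \<sigma>)"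
    using Suc.IH by blast
  obtain m11 m21 m31 m22 m32 m33 where m: "m11 \<ge> 0" "m22 \<ge> 0" "m33 \<ge> 0"
    "m11 * m11 = l11 * l11 + u n * u n"
    "m11 * m21 = l11 * l21 + u n * v n"
    "m11 * m31 = l11 * l31 + u n * w n"
    "m21 * m21 + m22 * m22 = l21 * l21 + l22 * l22 + v n * v n"
    "m21 * m31 + m22 * m32 = l21 * l31 + l22 * l32 + v n * w n"
    "m31 * m31 + m32 * m32 + m33 * m33 = l31 * l31 + l32 * l32 + l33 * l33 + w n * w n"
    and step: "\<And>F :: real \<times> real \<times> real \<Rightarrow> ennreal.
      F \<in> borel_measurable (borel \<Otimes>\<^sub>M borel \<Otimes>\<^sub>M borel) \<Longrightarrow>
      (\<integral>\<^sup>+x. \<integral>\<^sup>+y. \<integral>\<^sup>+t. \<integral>\<^sup>+r. F (l11 * x + r * u n, l21 * x + l22 * y + r * v n,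
          l31 * x + l32 * y + l33 * t + r * w n)
        \<partial>gauss_measure \<sigma> \<partial>gauss_measure \<sigma> \<partial>gauss_measure \<sigma> \<partial>gauss_measure \<sigma>)
      = (\<integral>\<^sup>+x. \<integral>\<^sup>+y. \<integral>\<^sup>+t. F (m11 * x, m21 * x + m22 * y, m31 * x + m32 * y + m33 * t)
        \<partial>gauss_measure \<sigma> \<partial>gauss_measure \<sigma> \<partial>gauss_measure \<sigma>)"
    using gauss_triangular_step[OF \<sigma> nonneg, of "u n" l21 "v n" l31 "w n" l32] by blast
  interpret G: prob_space "gauss_measure \<sigma>"
    using \<sigma> by (rule prob_space_gauss_measure)
  interpret P: product_sigma_finite "\<lambda>_::nat. gauss_measure \<sigma>" ..
  have law: "(\<integral>\<^sup>+z. F (\<Sum>t<Suc n. z t * u t, \<Sum>t<Suc n. z t * v t, \<Sum>t<Suc n. z t * w t)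
        \<partial>noise_measure (Suc n) \<sigma>)
      = (\<integral>\<^sup>+x. \<integral>\<^sup>+y. \<integral>\<^sup>+t. F (m11 * x, m21 * x + m22 * y, m31 * x + m32 * y + m33 * t)
        \<partial>gauss_measure \<sigma> \<partial>gauss_measure \<sigma> \<partial>gauss_measure \<sigma>)"
    if F[measurable]: "F \<in> borel_measurable (borel \<Otimes>\<^sub>M borel \<Otimes>\<^sub>M borel)"
    for F :: "real \<times> real \<times> real \<Rightarrow> ennreal"
  proof -
    \<comment> \<open>\<open>F'\<close> averages \<open>F\<close> over the newest coordinate. The
      induction hypothesis, which holds for every measurable function, is applied to
      \<open>F'\<close>.\<close>
    define F' where "F' = (\<lambda>(p, q, s). \<integral>\<^sup>+r. F (p + r * u n, q + r * v n, s + r * w n) \<partial>gauss_measure \<sigma>)"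
    have F'[measurable]: "F' \<in> borel_measurable (borel \<Otimes>\<^sub>M borel \<Otimes>\<^sub>M borel)"
      unfolding F'_def by measurable
    have "(\<integral>\<^sup>+z. F (\<Sum>t<Suc n. z t * u t, \<Sum>t<Suc n. z t * v t, \<Sum>t<Suc n. z t * w t)
          \<partial>noise_measure (Suc n) \<sigma>)
        = (\<integral>\<^sup>+z. F' (\<Sum>t<n. z t * u t, \<Sum>t<n. z t * v t, \<Sum>t<n. z t * w t) \<partial>noise_measure n \<sigma>)"
      unfolding noise_measure_def lessThan_Suc F'_def
      by (subst P.product_nn_integral_insert) (simp_all add: add.commute)
    also have "\<dots> = (\<integral>\<^sup>+x. \<integral>\<^sup>+y. \<integral>\<^sup>+t. F' (l11 * x, l21 * x + l22 * y, l31 * x + l32 * y + l33 * t)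
          \<partial>gauss_measure \<sigma> \<partial>gauss_measure \<sigma> \<partial>gauss_measure \<sigma>)"
      by (rule IH[OF F'])
    finally show ?thesis
      using step[OF F] by (simp add: F'_def)
  qed
  show ?case
    unfolding sum.lessThan_Suc
    by (rule exI[of _ m11], rule exI[of _ m21], rule exI[of _ m31],
      rule exI[of _ m22], rule exI[of _ m32], rule exI[of _ m33], intro conjI allI impI) (use m law gram in \<open>simp_all\<close>)
qed

section \<open>Pairwise error events\<close>

lemma hamming_weight_eq_sum: "real (hamming_weight n c) = (\<Sum>t<n. of_bool (c t))"
proof -
  have "{t. t < n \<and> c t} = {..<n} \<inter> {t. c t}"
    by auto
  then show ?thesis
    by (simp add: hamming_weight_def)
qed

lemma bxor_commute: "bxor a b = bxor b a"
  by (auto simp: bxor_def)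

text \<open>Coordinatewise this is the identity 2ab = a + b - (a xor b) for bits.\<close>

lemma two_mult_overlap:
  "2 * (\<Sum>t<n. of_bool (a t) * of_bool (b t) :: real)
    = real (hamming_weight n a) + real (hamming_weight n b) - real (hamming_weight n (bxor a b))"
  unfolding hamming_weight_eq_sum sum_distrib_left sum.distrib[symmetric] sum_subtractf[symmetric]
  by (rule sum.cong) (auto simp: bxor_def)

text \<open>The unit vector pointing from the transmitted signal towards the signal of \<open>c\<close>.\<close>

definition signal_dir :: "nat \<Rightarrow> (nat \<Rightarrow> bool) \<Rightarrow> nat \<Rightarrow> real" where
  "signal_dir n c t = - of_bool (c t) / sqrt (real (hamming_weight n c))"

text \<open>The two minus signs cancel, and the overlap of the supports is expressed by weights. If
  a weight is 0, both sides are 0 by the convention for division by zero.\<close>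

lemma signal_dir_inner:
  "(\<Sum>t<n. signal_dir n a t * signal_dir n b t)
    = (real (hamming_weight n a) + real (hamming_weight n b) - real (hamming_weight n (bxor a b)))
      / (2 * sqrt (real (hamming_weight n a) * real (hamming_weight n b)))"
proof -
  have "(\<Sum>t<n. signal_dir n a t * signal_dir n b t)
      = (\<Sum>t<n. of_bool (a t) * of_bool (b t))
        / (sqrt (real (hamming_weight n a)) * sqrt (real (hamming_weight n b)))"
    unfolding signal_dir_def sum_divide_distrib by (rule sum.cong) auto
  then show ?thesis
    unfolding two_mult_overlap[symmetric] by (simp add: real_sqrt_mult)
qed

lemma signal_dir_norm:
  assumes "hamming_weight n a \<ge> 1"
  shows "(\<Sum>t<n. signal_dir n a t * signal_dir n a t) = 1"
proof -
  have "hamming_weight n (bxor a a) = 0"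
    by (simp add: hamming_weight_def bxor_def)
  then show ?thesis
    using assms by (simp add: signal_dir_inner)
qed

text \<open>The two signals differ only on the support of \<open>c\<close>, where a noise value z
  contributes (2 + z)^2 - z^2 = 4 (1 + z) to the difference of squared distances. An error thus
  means that the projection of the noise reaches half the distance between the signals, the square
  root of the weight.\<close>

lemma pairwise_error_iff:
  assumes "hamming_weight n c \<ge> 1"
  shows "sqdist_n n (\<lambda>t. bpsk (\<lambda>_. False) t + z t) (bpsk c)
      \<le> sqdist_n n (\<lambda>t. bpsk (\<lambda>_. False) t + z t) (bpsk (\<lambda>_. False))
    \<longleftrightarrow> \<not> (\<Sum>t<n. z t * signal_dir n c t) < sqrt (real (hamming_weight n c))"
proof -
  define X where "X = (\<Sum>t<n. of_bool (c t) * z t)"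
  define W where "W = real (hamming_weight n c)"
  have W: "W > 0"
    using assms by (simp add: W_def)
  have dist: "sqdist_n n (\<lambda>t. bpsk (\<lambda>_. False) t + z t) (bpsk c)
      - sqdist_n n (\<lambda>t. bpsk (\<lambda>_. False) t + z t) (bpsk (\<lambda>_. False)) = 4 * (W + X)"
    unfolding sqdist_n_def W_def X_def hamming_weight_eq_sum sum_subtractf[symmetric]
      sum.distrib[symmetric] sum_distrib_left
    by (rule sum.cong) (auto simp: bpsk_def power2_eq_square algebra_simps)
  have proj: "(\<Sum>t<n. z t * signal_dir n c t) = - X / sqrt W"
    unfolding X_def W_def signal_dir_def sum_negf[symmetric] sum_divide_distrib
    by (rule sum.cong) auto
  have scale: "- X / sqrt W < sqrt W \<longleftrightarrow> - X < W"
    unfolding pos_divide_less_eq[OF real_sqrt_gt_zero[OF W]] using W by simp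
  have "a \<le> b \<longleftrightarrow> \<not> - X < W" if "a - b = 4 * (W + X)" for a b
    using that by auto
  then show ?thesis
    unfolding W_def[symmetric] proj scale using dist by blast
qed

text \<open>Strict Cauchy-Schwarz for the two reference directions. It makes
  \<open>sin_theta\<close> positive, so that the quotient in \<open>dir2\<close> is
  meaningful.\<close>

lemma cos_theta_sq_less_1:
  assumes "hamming_weight n a \<ge> 1" "hamming_weight n b \<ge> 1" "hamming_weight n (bxor b a) \<ge> 1"
  shows "(cos_theta (hamming_weight n a) (hamming_weight n b) (hamming_weight n (bxor b a)))\<^sup>2 < 1"
proof -
  define A B where "A = real (hamming_weight n a)" and "B = real (hamming_weight n b)"
  define m where "m = (\<Sum>t<n. of_bool (a t) * of_bool (b t) :: real)"
  have m2: "2 * m = A + B - real (hamming_weight n (bxor b a))"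
    unfolding m_def A_def B_def two_mult_overlap by (simp add: bxor_commute)
  have AB: "A > 0" "B > 0"
    using assms by (auto simp: A_def B_def)
  have m: "0 \<le> m" "m \<le> A" "m \<le> B"
    unfolding m_def A_def B_def hamming_weight_eq_sum
    by (rule sum_nonneg, simp) (rule sum_mono, simp)+
  \<comment> \<open>Equality in both bounds would give distance A + B - 2m = 0 between the two
    codewords.\<close>
  have "m < A \<or> m < B"
    using m2 assms(3) by linarith
  then have "m * m < A * B"
  proof
    assume "m < A"
    have "m * m \<le> m * B"
      using m by (intro mult_left_mono)
    also have "\<dots> < A * B"
      using \<open>m < A\<close> AB by simp
    finally show ?thesis .
  next
    assume "m < B"
    have "m * m \<le> A * m"
      using m by (intro mult_right_mono)
    also have "\<dots> < A * B"
      using \<open>m < B\<close> AB by simp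
    finally show ?thesis .
  qed
  moreover have "cos_theta (hamming_weight n a) (hamming_weight n b) (hamming_weight n (bxor b a))
      = m / sqrt (A * B)"
    unfolding cos_theta_def A_def[symmetric] B_def[symmetric] m2[symmetric] by simp
  ultimately show ?thesis
    using AB by (simp add: power_divide power2_eq_square)
qed

text \<open>The entries of the triangular matrix are forced by the Gram matrix: this is uniqueness of
  the Cholesky factor, where only the last diagonal entry may vanish.\<close>

lemma codeword_projection_law:
  fixes F :: "real \<times> real \<times> real \<Rightarrow> ennreal" and n :: nat and c1 c2 c :: "nat \<Rightarrow> bool"
  defines "d1 \<equiv> hamming_weight n c1" and "d2 \<equiv> hamming_weight n c2"
    and "d12 \<equiv> hamming_weight n (bxor c2 c1)"
    and "i \<equiv> hamming_weight n c" and "j \<equiv> hamming_weight n (bxor c c1)"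
    and "h \<equiv> hamming_weight n (bxor c c2)"
  assumes \<sigma>: "\<sigma> > 0" and pos: "d1 \<ge> 1" "d2 \<ge> 1" "d12 \<ge> 1" "i \<ge> 1"
    and F: "F \<in> borel_measurable (borel \<Otimes>\<^sub>M borel \<Otimes>\<^sub>M borel)"
  shows "(\<integral>\<^sup>+z. F (\<Sum>t<n. z t * signal_dir n c1 t, \<Sum>t<n. z t * signal_dir n c2 t,
        \<Sum>t<n. z t * signal_dir n c t) \<partial>noise_measure n \<sigma>)
    = (\<integral>\<^sup>+x. \<integral>\<^sup>+y. \<integral>\<^sup>+t. F (x, x * cos_theta d1 d2 d12 + y * sin_theta d1 d2 d12,
        x * dir1 d1 d2 d12 i j h + y * dir2 d1 d2 d12 i j h + t * dir3 d1 d2 d12 i j h)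
      \<partial>gauss_measure \<sigma> \<partial>gauss_measure \<sigma> \<partial>gauss_measure \<sigma>)"
proof -
  have g: "(\<Sum>t<n. signal_dir n c1 t * signal_dir n c1 t) = 1"
      "(\<Sum>t<n. signal_dir n c2 t * signal_dir n c2 t) = 1"
      "(\<Sum>t<n. signal_dir n c t * signal_dir n c t) = 1"
    using pos unfolding d1_def d2_def i_def by (auto intro: signal_dir_norm)
  have g12: "(\<Sum>t<n. signal_dir n c1 t * signal_dir n c2 t) = cos_theta d1 d2 d12"
    unfolding signal_dir_inner cos_theta_def d1_def d2_def d12_def by (simp add: bxor_commute)
  have g13: "(\<Sum>t<n. signal_dir n c1 t * signal_dir n c t) = dir1 d1 d2 d12 i j h"
    unfolding signal_dir_inner dir1_def d1_def i_def j_def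
    by (simp add: bxor_commute[of c c1] ac_simps)
  have g23: "(\<Sum>t<n. signal_dir n c2 t * signal_dir n c t)
      = (real i + real d2 - real h) / (2 * sqrt (real i * real d2))"
    unfolding signal_dir_inner d2_def i_def h_def
    by (simp add: bxor_commute[of c c2] ac_simps)
  obtain l11 l21 l31 l22 l32 l33 where nonneg: "l11 \<ge> 0" "l22 \<ge> 0" "l33 \<ge> 0"
    and gram: "l11 * l11 = 1" "l11 * l21 = cos_theta d1 d2 d12"
      "l11 * l31 = dir1 d1 d2 d12 i j h" "l21 * l21 + l22 * l22 = 1"
      "l21 * l31 + l22 * l32 = (real i + real d2 - real h) / (2 * sqrt (real i * real d2))"
      "l31 * l31 + l32 * l32 + l33 * l33 = 1"
    and law: "\<And>F :: real \<times> real \<times> real \<Rightarrow> ennreal.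
        F \<in> borel_measurable (borel \<Otimes>\<^sub>M borel \<Otimes>\<^sub>M borel) \<Longrightarrow>
        (\<integral>\<^sup>+z. F (\<Sum>t<n. z t * signal_dir n c1 t, \<Sum>t<n. z t * signal_dir n c2 t,
            \<Sum>t<n. z t * signal_dir n c t) \<partial>noise_measure n \<sigma>)
        = (\<integral>\<^sup>+x. \<integral>\<^sup>+y. \<integral>\<^sup>+t. F (l11 * x, l21 * x + l22 * y, l31 * x + l32 * y + l33 * t)
          \<partial>gauss_measure \<sigma> \<partial>gauss_measure \<sigma> \<partial>gauss_measure \<sigma>)"
    using gauss_vector_triangular[OF \<sigma>, where n = n and u = "signal_dir n c1"
      and v = "signal_dir n c2" and w = "signal_dir n c"]
    unfolding g g12 g13 g23 by blast
  have l11: "l11 = 1"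
    using gram(1) nonneg(1) by (simp add: square_eq_1_iff)
  have l21: "l21 = cos_theta d1 d2 d12" and l31: "l31 = dir1 d1 d2 d12 i j h"
    using gram(2,3) l11 by simp_all
  have "l22\<^sup>2 = 1 - (cos_theta d1 d2 d12)\<^sup>2"
    using gram(4) l21 by (simp add: power2_eq_square)
  then have l22: "l22 = sin_theta d1 d2 d12"
    unfolding sin_theta_def using nonneg(2) by (metis real_sqrt_abs abs_of_nonneg)
  \<comment> \<open>Solving the fifth Gram equation for \<open>l32\<close> means dividing by
    \<open>l22\<close>; the distinctness of the two reference codewords enters here.\<close>
  have "(cos_theta d1 d2 d12)\<^sup>2 < 1"
    using pos unfolding d1_def d2_def d12_def by (intro cos_theta_sq_less_1)
  then have "sin_theta d1 d2 d12 > 0"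
    by (simp add: sin_theta_def)
  then have l32: "l32 = dir2 d1 d2 d12 i j h"
    using gram(5) unfolding l21 l31 l22 dir2_def by (simp add: eq_divide_eq algebra_simps)
  have "l33\<^sup>2 = 1 - (dir1 d1 d2 d12 i j h)\<^sup>2 - (dir2 d1 d2 d12 i j h)\<^sup>2"
    using gram(6) l31 l32 by (simp add: power2_eq_square)
  then have l33: "l33 = dir3 d1 d2 d12 i j h"
    unfolding dir3_def using nonneg(3) by (metis real_sqrt_abs abs_of_nonneg)
  show ?thesis
    using law[OF F] unfolding l11 l21 l31 l22 l32 l33 by (simp add: mult.commute)
qed

section \<open>The integrals in \<open>p3\<close> and \<open>p4\<close> as iterated Gaussian
  integrals\<close>

lemma integral_indicator_gauss2:
  assumes \<sigma>[measurable]: "\<sigma> > 0" and S[measurable]: "S \<in> sets (borel \<Otimes>\<^sub>M borel)"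
  shows "(\<integral>x. indicator S x * (gauss \<sigma> (fst x) * gauss \<sigma> (snd x)) \<partial>(lborel \<Otimes>\<^sub>M lborel))
    = enn2real (\<integral>\<^sup>+x. \<integral>\<^sup>+y. indicator S (x, y) \<partial>gauss_measure \<sigma> \<partial>gauss_measure \<sigma>)"
proof -
  have [measurable]: "S \<in> sets (lborel \<Otimes>\<^sub>M lborel)"
    using S by (simp cong: sets_pair_measure_cong)
  have "(\<integral>x. indicator S x * (gauss \<sigma> (fst x) * gauss \<sigma> (snd x)) \<partial>(lborel \<Otimes>\<^sub>M lborel))
      = enn2real (\<integral>\<^sup>+x. ennreal (indicator S x * (gauss \<sigma> (fst x) * gauss \<sigma> (snd x)))
          \<partial>(lborel \<Otimes>\<^sub>M lborel))"
    by (rule integral_eq_nn_integral, measurable) (use \<sigma> in auto)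
  also have "(\<integral>\<^sup>+x. ennreal (indicator S x * (gauss \<sigma> (fst x) * gauss \<sigma> (snd x)))
          \<partial>(lborel \<Otimes>\<^sub>M lborel))
      = (\<integral>\<^sup>+x. \<integral>\<^sup>+y. ennreal (gauss \<sigma> x) * (ennreal (gauss \<sigma> y) * indicator S (x, y))
          \<partial>lborel \<partial>lborel)"
    by (subst lborel.nn_integral_fst[symmetric])
       (use \<sigma> in \<open>auto intro!: nn_integral_cong simp: ennreal_mult ennreal_indicator[symmetric] ac_simps\<close>)
  also have "\<dots> = (\<integral>\<^sup>+x. \<integral>\<^sup>+y. indicator S (x, y) \<partial>gauss_measure \<sigma> \<partial>gauss_measure \<sigma>)"
    by (rule nn_integral_gauss_pair[symmetric]) measurable
  finally show ?thesis .
qed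

lemma integral_indicator_gauss3:
  assumes \<sigma>[measurable]: "\<sigma> > 0" and S[measurable]: "S \<in> sets (borel \<Otimes>\<^sub>M borel \<Otimes>\<^sub>M borel)"
  shows "(\<integral>x. indicator S x * (gauss \<sigma> (fst x) * gauss \<sigma> (fst (snd x)) * gauss \<sigma> (snd (snd x)))
        \<partial>(lborel \<Otimes>\<^sub>M (lborel \<Otimes>\<^sub>M lborel)))
    = enn2real (\<integral>\<^sup>+x. \<integral>\<^sup>+y. \<integral>\<^sup>+t. indicator S (x, y, t)
        \<partial>gauss_measure \<sigma> \<partial>gauss_measure \<sigma> \<partial>gauss_measure \<sigma>)"
proof -
  let ?g = "\<lambda>x. ennreal (indicator S x * (gauss \<sigma> (fst x) * gauss \<sigma> (fst (snd x)) * gauss \<sigma> (snd (snd x))))"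
  \<comment> \<open>Splitting off the first coordinate by Tonelli needs the product of the other two
    to be sigma-finite; it is Lebesgue measure on the plane.\<close>
  have sf: "sigma_finite_measure (lborel \<Otimes>\<^sub>M lborel :: (real \<times> real) measure)"
    unfolding lborel_prod by (rule lborel.sigma_finite_measure_axioms)
  have [measurable]: "S \<in> sets (lborel \<Otimes>\<^sub>M (lborel \<Otimes>\<^sub>M lborel))"
    using S by (simp cong: sets_pair_measure_cong)
  have "(\<integral>x. indicator S x * (gauss \<sigma> (fst x) * gauss \<sigma> (fst (snd x)) * gauss \<sigma> (snd (snd x)))
        \<partial>(lborel \<Otimes>\<^sub>M (lborel \<Otimes>\<^sub>M lborel)))
      = enn2real (\<integral>\<^sup>+x. ?g x \<partial>(lborel \<Otimes>\<^sub>M (lborel \<Otimes>\<^sub>M lborel)))"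
    by (rule integral_eq_nn_integral, measurable) (use \<sigma> in auto)
  also have "(\<integral>\<^sup>+x. ?g x \<partial>(lborel \<Otimes>\<^sub>M (lborel \<Otimes>\<^sub>M lborel)))
      = (\<integral>\<^sup>+x. \<integral>\<^sup>+y. ?g (x, y) \<partial>(lborel \<Otimes>\<^sub>M lborel) \<partial>lborel)"
    by (rule sigma_finite_measure.nn_integral_fst[OF sf, symmetric]) measurable
  also have "\<dots> = (\<integral>\<^sup>+x. \<integral>\<^sup>+y. \<integral>\<^sup>+t. ?g (x, y, t) \<partial>lborel \<partial>lborel \<partial>lborel)"
    by (intro nn_integral_cong, rule lborel.nn_integral_fst[symmetric])
       (simp only: fst_conv snd_conv, measurable)
  also have "\<dots> = (\<integral>\<^sup>+x. ennreal (gauss \<sigma> x) * (\<integral>\<^sup>+y. \<integral>\<^sup>+t.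
        ennreal (gauss \<sigma> y) * (ennreal (gauss \<sigma> t) * indicator S (x, y, t)) \<partial>lborel \<partial>lborel) \<partial>lborel)"
    by (intro nn_integral_cong)
       (use \<sigma> in \<open>simp add: nn_integral_cmult[symmetric] ennreal_mult ennreal_indicator[symmetric] ac_simps\<close>)
  also have "\<dots> = (\<integral>\<^sup>+x. ennreal (gauss \<sigma> x) * (\<integral>\<^sup>+y. \<integral>\<^sup>+t. indicator S (x, y, t)
        \<partial>gauss_measure \<sigma> \<partial>gauss_measure \<sigma>) \<partial>lborel)"
    by (subst nn_integral_gauss_pair) measurable
  also have "\<dots> = (\<integral>\<^sup>+x. \<integral>\<^sup>+y. \<integral>\<^sup>+t. indicator S (x, y, t)
        \<partial>gauss_measure \<sigma> \<partial>gauss_measure \<sigma> \<partial>gauss_measure \<sigma>)"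
    by (rule nn_integral_gauss_measure[symmetric]) measurable
  finally show ?thesis .
qed

text \<open>Phrased through the projection rather than through distances, so that measurability is
  immediate and the projection law applies. The parameter \<open>\<sigma>\<close> enters only
  through the space.\<close>

definition pairwise_error :: "nat \<Rightarrow> real \<Rightarrow> (nat \<Rightarrow> bool) \<Rightarrow> (nat \<Rightarrow> real) set" where
  "pairwise_error n \<sigma> c = {z \<in> space (noise_measure n \<sigma>).
    \<not> (\<Sum>t<n. z t * signal_dir n c t) < sqrt (real (hamming_weight n c))}"

lemma prob_space_noise_measure: "\<sigma> > 0 \<Longrightarrow> prob_space (noise_measure n \<sigma>)"
  unfolding noise_measure_def by (intro prob_space_PiM prob_space_gauss_measure)

lemma borel_measurable_noise_projection [measurable]:
  "(\<lambda>z. \<Sum>t<n. z t * a t) \<in> borel_measurable (noise_measure n \<sigma>)"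
  unfolding noise_measure_def by measurable

lemma sets_pairwise_error [measurable]: "pairwise_error n \<sigma> c \<in> sets (noise_measure n \<sigma>)"
  unfolding pairwise_error_def by measurable

text \<open>\<open>p3\<close> is one minus the mass of the region without errors, so the probability
  is computed for the complement \<open>Q\<close>.\<close>

lemma prob_pairwise_error_Un2:
  assumes \<sigma>: "\<sigma> > 0" and "hamming_weight n c1 \<ge> 1" "hamming_weight n c2 \<ge> 1"
    "hamming_weight n (bxor c2 c1) \<ge> 1"
  shows "measure (noise_measure n \<sigma>) (pairwise_error n \<sigma> c1 \<union> pairwise_error n \<sigma> c2)
    = p3 \<sigma> (hamming_weight n c1) (hamming_weight n c2) (hamming_weight n (bxor c2 c1))"
proof -
  interpret N: prob_space "noise_measure n \<sigma>"
    using \<sigma> by (rule prob_space_noise_measure)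
  interpret G: prob_space "gauss_measure \<sigma>"
    using \<sigma> by (rule prob_space_gauss_measure)
  have one: "emeasure (gauss_measure \<sigma>) UNIV = 1"
    using G.emeasure_space_1 by simp
  let ?d1 = "hamming_weight n c1" and ?d2 = "hamming_weight n c2"
    and ?d12 = "hamming_weight n (bxor c2 c1)"
  define Q where "Q = space (noise_measure n \<sigma>) - (pairwise_error n \<sigma> c1 \<union> pairwise_error n \<sigma> c2)"
  \<comment> \<open>The projection law expects three directions. The third slot is filled with
    \<open>c1\<close> again and left unconstrained, so the integral over \<open>t\<close> equals
    1.\<close>
  define S where "S = {..<sqrt (real ?d1)} \<times> {..<sqrt (real ?d2)} \<times> (UNIV :: real set)"
  define T where "T = {(a, b). a < sqrt (real ?d1)
    \<and> a * cos_theta ?d1 ?d2 ?d12 + b * sin_theta ?d1 ?d2 ?d12 < sqrt (real ?d2)}"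
  have "T = {x \<in> space (borel \<Otimes>\<^sub>M borel). fst x < sqrt (real ?d1)
      \<and> fst x * cos_theta ?d1 ?d2 ?d12 + snd x * sin_theta ?d1 ?d2 ?d12 < sqrt (real ?d2)}"
    by (auto simp: T_def space_pair_measure)
  also have "\<dots> \<in> sets (borel \<Otimes>\<^sub>M borel)"
    by measurable
  finally have T: "T \<in> sets (borel \<Otimes>\<^sub>M borel)" .
  have S: "(indicator S :: _ \<Rightarrow> ennreal) \<in> borel_measurable (borel \<Otimes>\<^sub>M borel \<Otimes>\<^sub>M borel)"
    unfolding S_def by (intro borel_measurable_indicator pair_measureI) auto
  have "emeasure (noise_measure n \<sigma>) Q = (\<integral>\<^sup>+z. indicator Q z \<partial>noise_measure n \<sigma>)"
    by (rule nn_integral_indicator[symmetric]) (simp add: Q_def)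
  also have "\<dots> = (\<integral>\<^sup>+z. indicator S (\<Sum>t<n. z t * signal_dir n c1 t,
      \<Sum>t<n. z t * signal_dir n c2 t, \<Sum>t<n. z t * signal_dir n c1 t) \<partial>noise_measure n \<sigma>)"
    by (rule nn_integral_cong) (auto simp: Q_def S_def pairwise_error_def indicator_def)
  also have "\<dots> = (\<integral>\<^sup>+x. \<integral>\<^sup>+y. indicator T (x, y) \<partial>gauss_measure \<sigma> \<partial>gauss_measure \<sigma>)"
    by (subst codeword_projection_law[OF \<sigma> assms(2-4) assms(2) S])
       (auto simp: S_def T_def indicator_def one intro!: nn_integral_cong)
  finally have "measure (noise_measure n \<sigma>) Q
      = enn2real (\<integral>\<^sup>+x. \<integral>\<^sup>+y. indicator T (x, y) \<partial>gauss_measure \<sigma> \<partial>gauss_measure \<sigma>)"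
    by (simp add: measure_def)
  also have "\<dots> = 1 - p3 \<sigma> ?d1 ?d2 ?d12"
    unfolding integral_indicator_gauss2[OF \<sigma> T, symmetric] p3_def
    unfolding T_def by simp
  finally show ?thesis
    unfolding Q_def by (subst (asm) N.prob_compl) auto
qed

lemma prob_pairwise_error_Un3:
  assumes \<sigma>: "\<sigma> > 0" and "hamming_weight n c1 \<ge> 1" "hamming_weight n c2 \<ge> 1"
    "hamming_weight n (bxor c2 c1) \<ge> 1" "hamming_weight n c \<ge> 1"
  shows "measure (noise_measure n \<sigma>)
      (pairwise_error n \<sigma> c1 \<union> pairwise_error n \<sigma> c2 \<union> pairwise_error n \<sigma> c)
    = p4 \<sigma> (hamming_weight n c1) (hamming_weight n c2) (hamming_weight n (bxor c2 c1))
        (hamming_weight n c) (hamming_weight n (bxor c c1)) (hamming_weight n (bxor c c2))"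
proof -
  interpret N: prob_space "noise_measure n \<sigma>"
    using \<sigma> by (rule prob_space_noise_measure)
  let ?d1 = "hamming_weight n c1" and ?d2 = "hamming_weight n c2"
    and ?d12 = "hamming_weight n (bxor c2 c1)" and ?i = "hamming_weight n c"
    and ?j = "hamming_weight n (bxor c c1)" and ?h = "hamming_weight n (bxor c c2)"
  define Q where "Q = space (noise_measure n \<sigma>)
    - (pairwise_error n \<sigma> c1 \<union> pairwise_error n \<sigma> c2 \<union> pairwise_error n \<sigma> c)"
  define S where "S = {..<sqrt (real ?d1)} \<times> {..<sqrt (real ?d2)} \<times> {..<sqrt (real ?i)}"
  define T where "T = {(a, b, c). a < sqrt (real ?d1)
    \<and> a * cos_theta ?d1 ?d2 ?d12 + b * sin_theta ?d1 ?d2 ?d12 < sqrt (real ?d2)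
    \<and> a * dir1 ?d1 ?d2 ?d12 ?i ?j ?h + b * dir2 ?d1 ?d2 ?d12 ?i ?j ?h
        + c * dir3 ?d1 ?d2 ?d12 ?i ?j ?h < sqrt (real ?i)}"
  have "T = {x \<in> space (borel \<Otimes>\<^sub>M borel \<Otimes>\<^sub>M borel). fst x < sqrt (real ?d1)
      \<and> fst x * cos_theta ?d1 ?d2 ?d12 + fst (snd x) * sin_theta ?d1 ?d2 ?d12 < sqrt (real ?d2)
      \<and> fst x * dir1 ?d1 ?d2 ?d12 ?i ?j ?h + fst (snd x) * dir2 ?d1 ?d2 ?d12 ?i ?j ?h
          + snd (snd x) * dir3 ?d1 ?d2 ?d12 ?i ?j ?h < sqrt (real ?i)}"
    by (auto simp: T_def space_pair_measure)
  also have "\<dots> \<in> sets (borel \<Otimes>\<^sub>M borel \<Otimes>\<^sub>M borel)"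
    by measurable
  finally have T: "T \<in> sets (borel \<Otimes>\<^sub>M borel \<Otimes>\<^sub>M borel)" .
  have S: "(indicator S :: _ \<Rightarrow> ennreal) \<in> borel_measurable (borel \<Otimes>\<^sub>M borel \<Otimes>\<^sub>M borel)"
    unfolding S_def by (intro borel_measurable_indicator pair_measureI) auto
  have "emeasure (noise_measure n \<sigma>) Q = (\<integral>\<^sup>+z. indicator Q z \<partial>noise_measure n \<sigma>)"
    by (rule nn_integral_indicator[symmetric]) (simp add: Q_def)
  also have "\<dots> = (\<integral>\<^sup>+z. indicator S (\<Sum>t<n. z t * signal_dir n c1 t,
      \<Sum>t<n. z t * signal_dir n c2 t, \<Sum>t<n. z t * signal_dir n c t) \<partial>noise_measure n \<sigma>)"
    by (rule nn_integral_cong) (auto simp: Q_def S_def pairwise_error_def indicator_def)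
  also have "\<dots> = (\<integral>\<^sup>+x. \<integral>\<^sup>+y. \<integral>\<^sup>+t. indicator T (x, y, t)
      \<partial>gauss_measure \<sigma> \<partial>gauss_measure \<sigma> \<partial>gauss_measure \<sigma>)"
    by (subst codeword_projection_law[OF \<sigma> assms(2-5) S])
       (auto simp: S_def T_def indicator_def intro!: nn_integral_cong)
  finally have "measure (noise_measure n \<sigma>) Q
      = enn2real (\<integral>\<^sup>+x. \<integral>\<^sup>+y. \<integral>\<^sup>+t. indicator T (x, y, t)
          \<partial>gauss_measure \<sigma> \<partial>gauss_measure \<sigma> \<partial>gauss_measure \<sigma>)"
    by (simp add: measure_def)
  also have "\<dots> = 1 - p4 \<sigma> ?d1 ?d2 ?d12 ?i ?j ?h"
    unfolding integral_indicator_gauss3[OF \<sigma> T, symmetric] p4_def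
    unfolding T_def by simp
  finally show ?thesis
    unfolding Q_def by (subst (asm) N.prob_compl) auto
qed

section \<open>The union bound\<close>

text \<open>Only the parts \<open>A i - B\<close> enter the union bound, and each has measure
  \<open>measure M (B \<union> A i) - measure M B\<close>.\<close>

lemma (in finite_measure) measure_Un_UN_le:
  assumes "finite I" "B \<in> sets M" "\<And>i. i \<in> I \<Longrightarrow> A i \<in> sets M"
  shows "measure M (B \<union> (\<Union>i\<in>I. A i)) \<le> measure M B + (\<Sum>i\<in>I. measure M (B \<union> A i) - measure M B)"
proof -
  have "B \<union> (\<Union>i\<in>I. A i) = B \<union> (\<Union>i\<in>I. A i - B)"
    by auto
  then have "measure M (B \<union> (\<Union>i\<in>I. A i)) \<le> measure M B + measure M (\<Union>i\<in>I. A i - B)"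
    using assms by (metis (no_types, lifting) measure_Un_le sets.Diff sets.finite_UN)
  also have "measure M (\<Union>i\<in>I. A i - B) \<le> (\<Sum>i\<in>I. measure M (A i - B))"
    using assms by (intro measure_UNION_le) auto
  also have "\<dots> = (\<Sum>i\<in>I. measure M (B \<union> A i) - measure M B)"
    using assms by (intro sum.cong) (auto simp: finite_measure_Union' Un_commute)
  finally show ?thesis
    by simp
qed

section \<open>Counting codewords by their triple of weights\<close>

lemma hamming_weight_pos:
  assumes "c \<in> bvec n" "c \<noteq> (\<lambda>_. False)"
  shows "hamming_weight n c \<ge> 1"
proof -
  obtain t where "c t"
    using assms(2) by auto
  then have "t \<in> {t. t < n \<and> c t}"
    using assms(1) by (auto simp: bvec_def not_le[symmetric])
  then show ?thesis
    by (auto simp: hamming_weight_def Suc_le_eq card_gt_0_iff)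
qed

lemma hamming_weight_le: "hamming_weight n c \<le> n"
proof -
  have "card {t. t < n \<and> c t} \<le> card {..<n}"
    by (rule card_mono) auto
  then show ?thesis
    by (simp add: hamming_weight_def)
qed

text \<open>The codewords are grouped by the triple \<open>\<kappa> c\<close>. Starting the indices
  at 1 removes exactly the zero word (\<open>i = 0\<close>), \<open>c1\<close>
  (\<open>j = 0\<close>) and \<open>c2\<close> (\<open>h = 0\<close>).\<close>

lemma tetra_spectrum_sum:
  fixes g :: "nat \<Rightarrow> nat \<Rightarrow> nat \<Rightarrow> real"
  assumes C: "binary_linear_code n k C" and c: "c1 \<in> C" "c2 \<in> C"
  shows "(\<Sum>i\<in>{1..n}. \<Sum>j\<in>{1..n}. \<Sum>h\<in>{1..n}. real (tetra_spectrum n C c1 c2 i j h) * g i j h)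
    = (\<Sum>c\<in>C - {\<lambda>_. False, c1, c2}.
        g (hamming_weight n c) (hamming_weight n (bxor c c1)) (hamming_weight n (bxor c c2)))"
proof -
  let ?C = "C - {\<lambda>_. False, c1, c2}"
  define \<kappa> where "\<kappa> c = (hamming_weight n c, hamming_weight n (bxor c c1), hamming_weight n (bxor c c2))" for c
  define T where "T = {1..n} \<times> {1..n} \<times> {1..n}"
  have fin: "finite C"
    using C by (intro card_ge_0_finite) (simp add: binary_linear_code_def)
  have bv: "C \<subseteq> bvec n" and xor: "\<And>a b. a \<in> C \<Longrightarrow> b \<in> C \<Longrightarrow> bxor a b \<in> bvec n"
    using C by (auto simp: binary_linear_code_def)
  have neq: "bxor a b \<noteq> (\<lambda>_. False)" if "a \<noteq> b" for a b
    using that by (auto simp: bxor_def fun_eq_iff)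
  have \<kappa>: "\<kappa> ` ?C \<subseteq> T"
    using bv xor neq c
    by (auto simp: \<kappa>_def T_def hamming_weight_le intro!: hamming_weight_pos[unfolded One_nat_def])
  have zero: "hamming_weight n (\<lambda>_. False) = 0" "hamming_weight n (bxor c c) = 0" for c
    by (simp_all add: hamming_weight_def bxor_def)
  have spec: "real (tetra_spectrum n C c1 c2 i j h) * g i j h
      = (\<Sum>c | c \<in> ?C \<and> \<kappa> c = (i, j, h). case \<kappa> c of (i, j, h) \<Rightarrow> g i j h)"
    if "(i, j, h) \<in> T" for i j h
  proof -
    have "{c \<in> C. hamming_weight n c = i \<and> hamming_weight n (bxor c c1) = j
        \<and> hamming_weight n (bxor c c2) = h} = {c. c \<in> ?C \<and> \<kappa> c = (i, j, h)}"
      using that zero by (auto simp: \<kappa>_def T_def)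
    then show ?thesis
      by (simp add: tetra_spectrum_def)
  qed
  have "(\<Sum>i\<in>{1..n}. \<Sum>j\<in>{1..n}. \<Sum>h\<in>{1..n}. real (tetra_spectrum n C c1 c2 i j h) * g i j h)
      = (\<Sum>(i, j, h)\<in>T. real (tetra_spectrum n C c1 c2 i j h) * g i j h)"
    unfolding T_def by (simp add: sum.cartesian_product)
  also have "\<dots> = (\<Sum>y\<in>T. \<Sum>c | c \<in> ?C \<and> \<kappa> c = y. case \<kappa> c of (i, j, h) \<Rightarrow> g i j h)"
    by (rule sum.cong) (use spec in auto)
  also have "\<dots> = (\<Sum>c\<in>?C. case \<kappa> c of (i, j, h) \<Rightarrow> g i j h)"
    by (rule sum.group) (use fin \<kappa> in \<open>auto simp: T_def\<close>)
  finally show ?thesis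
    by (simp add: \<kappa>_def)
qed

theorem theorem2:
  fixes n k :: nat and C :: "(nat \<Rightarrow> bool) set" and c1 c2 :: "nat \<Rightarrow> bool" and \<sigma> :: real
  assumes "binary_linear_code n k C"
    and "\<sigma> > 0"
    and "c1 \<in> C" and "c2 \<in> C"
    and "hamming_weight n c1 \<ge> 1"
    and "hamming_weight n c2 \<ge> 1"
    and "hamming_weight n (bxor c2 c1) \<ge> 1"
  shows "measure (noise_measure n \<sigma>) (error_event n C)
     \<le> - (2 ^ k - 4) * p3 \<sigma> (hamming_weight n c1) (hamming_weight n c2)
                              (hamming_weight n (bxor c2 c1))
       + (\<Sum>i\<in>{1..n}. \<Sum>j\<in>{1..n}. \<Sum>h\<in>{1..n}.
            real (tetra_spectrum n C c1 c2 i j h)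
            * p4 \<sigma> (hamming_weight n c1) (hamming_weight n c2)
                   (hamming_weight n (bxor c2 c1)) i j h)"
proof -
  interpret N: prob_space "noise_measure n \<sigma>"
    using assms(2) by (rule prob_space_noise_measure)
  let ?C = "C - {\<lambda>_. False, c1, c2}"
  let ?B = "pairwise_error n \<sigma> c1 \<union> pairwise_error n \<sigma> c2"
  let ?p3 = "p3 \<sigma> (hamming_weight n c1) (hamming_weight n c2) (hamming_weight n (bxor c2 c1))"
  let ?p4 = "p4 \<sigma> (hamming_weight n c1) (hamming_weight n c2) (hamming_weight n (bxor c2 c1))"
  have C: "C \<subseteq> bvec n" "(\<lambda>_. False) \<in> C" "card C = 2 ^ k"
    using assms(1) by (auto simp: binary_linear_code_def)
  have fin: "finite C"
    using C(3) by (intro card_ge_0_finite) simp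
  have ne: "c1 \<noteq> (\<lambda>_. False)" "c2 \<noteq> (\<lambda>_. False)" "c1 \<noteq> c2"
    using assms(5-7) by (auto simp: hamming_weight_def bxor_def)
  have pos: "hamming_weight n c \<ge> 1" if "c \<in> C" "c \<noteq> (\<lambda>_. False)" for c
    using that C(1) by (intro hamming_weight_pos) auto
  have card3: "card {\<lambda>_. False, c1, c2} = 3"
    using ne by auto
  have sub3: "{\<lambda>_. False, c1, c2} \<subseteq> C"
    using C(2) assms(3,4) by auto
  \<comment> \<open>A code containing three distinct words has \<open>2 ^ k \<ge> 3\<close>, so the
    natural-number difference is not truncated.\<close>
  have card: "real (card ?C) = 2 ^ k - 3"
    using card_Diff_subset[OF _ sub3] card_mono[OF fin sub3]
    by (simp add: card3 C(3) of_nat_diff)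
  have space: "space (PiM {..<n} (\<lambda>_. lborel :: real measure)) = space (noise_measure n \<sigma>)"
    by (simp add: noise_measure_def space_PiM)
  have "error_event n C = (\<Union>c\<in>C - {\<lambda>_. False}. pairwise_error n \<sigma> c)"
    unfolding error_event_def space pairwise_error_def
    using pairwise_error_iff[OF pos] by blast
  also have "\<dots> = ?B \<union> (\<Union>c\<in>?C. pairwise_error n \<sigma> c)"
    using assms(3,4) ne by blast
  finally have "measure (noise_measure n \<sigma>) (error_event n C)
      \<le> measure (noise_measure n \<sigma>) ?B
        + (\<Sum>c\<in>?C. measure (noise_measure n \<sigma>) (?B \<union> pairwise_error n \<sigma> c)
            - measure (noise_measure n \<sigma>) ?B)"
    using fin by (simp only:) (intro N.measure_Un_UN_le, auto)
  also have "\<dots> = ?p3 + (\<Sum>c\<in>?C. ?p4 (hamming_weight n c) (hamming_weight n (bxor c c1))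
      (hamming_weight n (bxor c c2)) - ?p3)"
    using assms pos by (simp add: prob_pairwise_error_Un2 prob_pairwise_error_Un3)
  \<comment> \<open>The \<open>2 ^ k - 3\<close> subtracted copies of \<open>?p3\<close> meet the
    single one in front, which leaves the coefficient \<open>- (2 ^ k - 4)\<close>.\<close>
  also have "\<dots> = - (2 ^ k - 4) * ?p3 + (\<Sum>c\<in>?C. ?p4 (hamming_weight n c)
      (hamming_weight n (bxor c c1)) (hamming_weight n (bxor c c2)))"
    unfolding sum_subtractf sum_constant card by (simp add: algebra_simps)
  finally show ?thesis
    unfolding tetra_spectrum_sum[OF assms(1,3,4)] .
qed

end
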